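(* Let $H(t)=e^{-t/2}$ for $t\ge 0$, and let $n\ge0$ be an integer. The quadratic form $(\log 2\pi)\,\phi_n^2-\mathrm{q}_n^H$ on $\mathbb{R}^{n+1}$ is positive definite if and only if $0\le n\le24$. For $n\geq25$, this form is negative on the vector $\left(\binom{2k}{k}\binom{2(n-k)}{n-k}\right)_{0\le k\le n}$.
   Context: On $\mathbb{R}^{n+1}$, $\phi_n(x)=\sum_{0\le k\le n}x_k$ and $\mathrm{q}_n^H(x)=\sum_{0\le i,j\le n}x_ix_j\,\psi_H(|i-j|)$, where $\psi_H(s)=\int_0^\infty\left(H(0)\frac{e^{-t}}{t}-H(t)\frac{e^{-st}}{1-e^{-t}}\right)\mathrm{d}t$; for this $H$ one has $\psi_H(s)=\psi(\frac12+s)$ with $\psi=\Gamma'/\Gamma$. *)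

theory Defs
  imports "HOL-Analysis.Analysis" "Jordan_Normal_Form.Matrix"
begin

text \<open>
  Henstock-Kurzweil integral, which also covers improperly convergent cases; over the open
  half-line, so that no division by zero occurs in the integrand.
\<close>
definition psi_H :: "(real \<Rightarrow> real) \<Rightarrow> real \<Rightarrow> real" where
  "psi_H H s = integral {0<..}
     (\<lambda>t. H 0 * (exp (- t) / t) - H t * (exp (- s * t) / (1 - exp (- t))))"

text \<open>
  The space $R^{n+1}$ is \<open>carrier_vec (n + 1)\<close>, with coordinates $x_0, \dots, x_n$.
\<close>
definition phi_form :: "nat \<Rightarrow> real vec \<Rightarrow> real" where
  "phi_form n x = (\<Sum>k\<le>n. vec_index x k)"

definition q_form :: "(real \<Rightarrow> real) \<Rightarrow> nat \<Rightarrow> real vec \<Rightarrow> real" where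
  "q_form H n x =
     (\<Sum>i\<le>n. \<Sum>j\<le>n. vec_index x i * vec_index x j * psi_H H \<bar>real i - real j\<bar>)"

definition positive_definite_on :: "nat \<Rightarrow> (real vec \<Rightarrow> real) \<Rightarrow> bool" where
  "positive_definite_on d Q \<longleftrightarrow> (\<forall>x \<in> carrier_vec d. x \<noteq> 0\<^sub>v d \<longrightarrow> Q x > 0)"

end

theory Submission
  imports Defs "HOL-Real_Asymp.Real_Asymp"
begin

text \<open>
  Put \<open>w\<^sub>k = 4\<^bsup>-n\<^esup> (2k choose k) (2(n-k) choose (n-k))\<close>, a probability vector (Vandermonde with
  both parameters \<open>1/2\<close>). Its potential \<open>\<Sum>j. w\<^sub>j \<psi>(1/2 + |i - j|)\<close> does not depend on \<open>i\<close>: the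
  successive differences are values of \<open>\<Sum>j. w\<^sub>j / (x - j)\<close> at half-integers, where this
  rational function has its zeros. The constant is \<open>\<psi>(1/2) + H\<^sub>n\<close>, with \<open>H\<^sub>n\<close> the harmonic number.
  Since \<open>-q\<close> is positive definite on the vectors of coordinate sum zero, writing
  \<open>x = \<phi>(x) w + y\<close> diagonalises the form as
  \<open>\<phi>(x)\<^sup>2 (log 2\<pi> - \<psi>(1/2) - H\<^sub>n) - q(y)\<close>. As \<open>\<psi>(1/2) = -\<gamma> - 2 log 2\<close>, everything depends on
  the sign of \<open>log 8\<pi> + \<gamma> - H\<^sub>n\<close>, which changes between \<open>n = 24\<close> and \<open>n = 25\<close>.
\<close>

subsection \<open>The equilibrium vector\<close>

text \<open>The coefficient of \<open>x ^ k\<close> in \<open>(1 - x) powr (- 1/2)\<close>. The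
  Pochhammer form exposes the parameter \<open>1/2\<close>, which is varied below.\<close>

definition central_coeff :: "nat \<Rightarrow> real" where
  "central_coeff k = pochhammer (1/2) k / fact k"

definition arcsine_weight :: "nat \<Rightarrow> nat \<Rightarrow> real" where
  "arcsine_weight n k = central_coeff k * central_coeff (n - k)"

text \<open>The digamma difference \<open>psi (m + 1/2) - psi (1/2)\<close>, by the recurrence
  \<open>psi (x + 1) = psi x + 1 / x\<close>.\<close>

definition odd_harm :: "nat \<Rightarrow> real" where
  "odd_harm m = (\<Sum>k<m. 1 / (real k + 1/2))"

text \<open>One of the two truncated differences is always zero. A natural distance can serve as an
  exponent and as argument of \<open>odd_harm\<close>.\<close>

definition ndist :: "nat \<Rightarrow> nat \<Rightarrow> nat" where
  "ndist i j = (i - j) + (j - i)"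

lemma ndist_commute: "ndist i j = ndist j i"
  by (simp add: ndist_def)

lemma real_ndist: "real (ndist i j) = \<bar>real i - real j\<bar>"
  by (cases "i \<le> j") (auto simp: ndist_def of_nat_diff)

lemma central_binomial_eq: "real ((2 * k) choose k) = 4 ^ k * central_coeff k"
proof -
  have "real ((2 * k) choose k) = fact (2 * k) / (fact k * fact k)"
    using binomial_fact[of k "2 * k", where ?'a = real] by simp
  then show ?thesis
    by (simp add: fact_double central_coeff_def power_mult)
qed

text \<open>Chu-Vandermonde for generalised binomials at \<open>-a\<close> and \<open>-b\<close>;
  the signs of the two factors combine to \<open>(-1) ^ n\<close>.\<close>

lemma pochhammer_Vandermonde:
  fixes a b :: "'a :: field_char_0"
  shows "(\<Sum>k\<le>n. (pochhammer a k / fact k) * (pochhammer b (n - k) / fact (n - k)))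
    = pochhammer (a + b) n / fact n"
proof -
  have "(-1) ^ n * (\<Sum>k\<le>n. (pochhammer a k / fact k) * (pochhammer b (n - k) / fact (n - k)))
      = (\<Sum>k\<le>n. ((-a) gchoose k) * ((-b) gchoose (n - k)))"
    by (subst sum_distrib_left, rule sum.cong)
       (auto simp: gbinomial_pochhammer simp flip: power_add)
  also have "\<dots> = (- a + - b) gchoose n"
    using gbinomial_Vandermonde[of "-a" "-b" n] by (simp add: atMost_atLeast0)
  also have "\<dots> = (-1) ^ n * (pochhammer (a + b) n / fact n)"
    by (simp add: gbinomial_pochhammer add.commute)
  finally show ?thesis by (simp only: mult_cancel_left) simp
qed

lemma sum_arcsine_weight: "(\<Sum>k\<le>n. arcsine_weight n k) = 1"
  unfolding arcsine_weight_def central_coeff_def pochhammer_Vandermonde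
  by (simp flip: pochhammer_fact)

lemma has_field_derivative_pochhammer:
  fixes x :: real
  assumes "x > 0"
  shows "((\<lambda>x. pochhammer x n) has_real_derivative
    pochhammer x n * (\<Sum>k<n. 1 / (x + real k))) (at x)"
proof (induction n)
  case (Suc n)
  have "x + real n > 0" using assms by simp
  then show ?case
    unfolding pochhammer_Suc
    by (auto intro!: derivative_eq_intros Suc simp: field_simps)
qed simp

text \<open>Differentiate the Vandermonde identity in the first parameter.\<close>
lemma sum_arcsine_weight_odd_harm: "(\<Sum>j\<le>n. arcsine_weight n j * odd_harm j) = harm n"
proof -
  let ?f = "\<lambda>x. \<Sum>k\<le>n. (pochhammer x k / fact k) * central_coeff (n - k)"
  let ?g = "\<lambda>x::real. pochhammer (x + 1/2) n / fact n"
  have "(?f has_real_derivative (\<Sum>k\<le>n. arcsine_weight n k * odd_harm k)) (at (1/2))"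
    by (auto intro!: derivative_eq_intros has_field_derivative_pochhammer sum.cong
        simp: arcsine_weight_def central_coeff_def odd_harm_def add.commute)
  moreover have "?f = ?g"
    unfolding central_coeff_def pochhammer_Vandermonde ..
  moreover have "(?g has_real_derivative harm n) (at (1/2))"
    by (rule derivative_eq_intros DERIV_chain2[OF has_field_derivative_pochhammer] | simp)+
       (simp add: harm_altdef inverse_eq_divide flip: pochhammer_fact)
  ultimately show ?thesis by (metis DERIV_unique)
qed

text \<open>
  The left side consists of the partial fractions of
  \<open>(\<Prod>k<n. x - k - 1/2) / (\<Prod>k\<le>n. x - k)\<close> at \<open>x = i + 1/2\<close>.
\<close>
lemma sum_arcsine_weight_partial_fractions:
  assumes "i < n"
  shows "(\<Sum>j\<le>n. arcsine_weight n j / (real i + 1/2 - real j)) = 0"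
proof -
  \<comment> \<open>Unnormalised Lagrange basis polynomials for the nodes \<open>0..n\<close>, so
    \<open>p\<close> is the numerator of the partial fraction sum. It equals \<open>q\<close>
    because both have degree at most \<open>n\<close> and agree at these \<open>n + 1\<close>
    nodes.\<close>
  define L where "L j = (\<Prod>l\<in>{..n} - {j}. [:- real l, 1:])" for j
  define p where "p = (\<Sum>j\<le>n. Polynomial.smult (arcsine_weight n j) (L j))"
  define q where "q = (\<Prod>k<n. [:- (real k + 1/2), 1:])"
  have degL: "degree (L j) \<le> n" if "j \<le> n" for j
    using that degree_prod_sum_le[of "{..n} - {j}" "\<lambda>l. [:- real l, 1:]"]
    by (simp add: L_def o_def)
  have "degree p \<le> n"
    unfolding p_def by (intro degree_sum_le) (auto intro!: degL order.trans[OF degree_smult_le])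
  moreover have "degree q \<le> n"
    using degree_prod_sum_le[of "{..<n}" "\<lambda>k. [:- (real k + 1/2), 1:]"]
    by (simp add: q_def o_def)
  moreover have "poly p m = poly q m" if mem: "m \<in> real ` {..n}" for m
  proof -
    obtain m' where m': "m = real m'" "m' \<le> n" using mem by blast
    have "poly p m = (\<Sum>j\<le>n. if j = m' then arcsine_weight n j * poly (L j) m else 0)"
      unfolding p_def poly_sum using m'
      by (intro sum.cong) (auto simp: L_def poly_prod prod_zero_iff)
    also have "\<dots> = arcsine_weight n m' * (\<Prod>l\<in>{..n} - {m'}. real m' - real l)"
      using m' by (simp add: L_def poly_prod)
    \<comment> \<open>Up to sign, the nodes below \<open>m'\<close> contribute
      \<open>fact m'\<close> and those above contribute \<open>fact (n - m')\<close>; these cancel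
      the denominators of the weight.\<close>
    also have "{..n} - {m'} = {..<m'} \<union> {Suc m'..<Suc n}" using m' by auto
    also have "(\<Prod>l\<in>{..<m'} \<union> {Suc m'..<Suc n}. real m' - real l)
        = (\<Prod>l<m'. real m' - real l) * (\<Prod>l=Suc m'..<Suc n. real m' - real l)"
      by (intro prod.union_disjoint) auto
    also have "(\<Prod>l<m'. real m' - real l) = (\<Prod>l<m'. (\<lambda>k. real (Suc k)) (m' - Suc l))"
      by (intro prod.cong) auto
    also have "\<dots> = fact m'"
      by (subst prod.nat_diff_reindex)
         (simp add: fact_prod_Suc lessThan_atLeast0)
    also have "(\<Prod>l=Suc m'..<Suc n. real m' - real l) = (\<Prod>l<n - m'. - real (Suc l))"
      by (subst prod.atLeastLessThan_shift_0) (simp add: lessThan_atLeast0)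
    also have "\<dots> = (-1) ^ (n - m') * fact (n - m')"
      by (simp only: prod_uminus) (simp add: fact_prod_Suc lessThan_atLeast0)
    finally have 1: "poly p m = (-1) ^ (n - m') * pochhammer (1/2) m' * pochhammer (1/2) (n - m')"
      by (simp add: arcsine_weight_def central_coeff_def)
    have "poly q m = (\<Prod>k<n. real m' - real k - 1/2)"
      by (simp add: q_def poly_prod m' algebra_simps)
    also have "{..<n} = {..<m'} \<union> {m'..<n}" using m' by auto
    also have "(\<Prod>k\<in>{..<m'} \<union> {m'..<n}. real m' - real k - 1/2)
        = (\<Prod>k<m'. real m' - real k - 1/2) * (\<Prod>k=m'..<n. real m' - real k - 1/2)"
      by (intro prod.union_disjoint) auto
    also have "(\<Prod>k<m'. real m' - real k - 1/2) = (\<Prod>k<m'. (\<lambda>k. 1/2 + real k) (m' - Suc k))"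
      by (intro prod.cong) (auto simp: of_nat_diff field_simps)
    also have "\<dots> = pochhammer (1/2) m'"
      by (subst prod.nat_diff_reindex) (simp add: pochhammer_prod lessThan_atLeast0)
    also have "(\<Prod>k=m'..<n. real m' - real k - 1/2) = (\<Prod>k<n - m'. - (1/2 + real k))"
      by (subst prod.atLeastLessThan_shift_0) (simp add: lessThan_atLeast0 algebra_simps)
    also have "\<dots> = (-1) ^ (n - m') * pochhammer (1/2) (n - m')"
      by (simp only: prod_uminus) (simp add: pochhammer_prod lessThan_atLeast0)
    finally show ?thesis using 1 by simp
  qed
  moreover have "card (real ` {..n}) = Suc n"
    by (simp add: card_image inj_on_def)
  ultimately have "p = q"
    by (intro poly_eqI_degree[where A = "real ` {..n}"]) auto
  define x where "x = real i + 1/2"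
  have ne: "x - real j \<noteq> 0" for j
  proof
    assume "x - real j = 0"
    then have "real (2 * i + 1) = real (2 * j)" by (simp add: x_def)
    then show False unfolding of_nat_eq_iff by presburger
  qed
  have "poly (L j) x = (\<Prod>l\<le>n. x - real l) / (x - real j)" if "j \<le> n" for j
    using that ne[of j] prod.remove[of "{..n}" j "\<lambda>l. x - real l"]
    by (simp only: L_def poly_prod) simp
  then have "poly p x = (\<Prod>l\<le>n. x - real l) * (\<Sum>j\<le>n. arcsine_weight n j / (x - real j))"
    unfolding p_def poly_sum sum_distrib_left by (intro sum.cong) auto
  \<comment> \<open>Since \<open>i < n\<close>, the point \<open>i + 1/2\<close> is a root of
    \<open>q\<close>.\<close>
  moreover have "poly q x = 0"
    using assms unfolding q_def poly_prod by (intro prod_zero) (auto simp: x_def)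
  ultimately show ?thesis
    using \<open>p = q\<close> ne by (simp add: prod_zero_iff x_def)
qed

lemma sum_arcsine_weight_ndist:
  assumes "i \<le> n"
  shows "(\<Sum>j\<le>n. arcsine_weight n j * odd_harm (ndist i j)) = harm n"
  using assms
proof (induction i)
  case 0
  then show ?case using sum_arcsine_weight_odd_harm[of n] by (simp add: ndist_def)
next
  case (Suc i)
  \<comment> \<open>For \<open>j \<le> i\<close> the distance grows and a term is gained; for
    \<open>j > i\<close> it shrinks and a term is lost, which accounts for the negative sign of the
    right side.\<close>
  have step: "odd_harm (ndist (Suc i) j) - odd_harm (ndist i j) = 1 / (real i + 1/2 - real j)" for j
  proof (cases "j \<le> i")
    case True
    then show ?thesis by (simp add: ndist_def odd_harm_def Suc_diff_le of_nat_diff algebra_simps)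
  next
    case False
    then obtain d where "j = i + Suc d" by (metis add_Suc_right less_imp_Suc_add not_le)
    then show ?thesis by (simp add: ndist_def odd_harm_def field_simps)
  qed
  have "(\<Sum>j\<le>n. arcsine_weight n j * odd_harm (ndist (Suc i) j))
      - (\<Sum>j\<le>n. arcsine_weight n j * odd_harm (ndist i j))
      = (\<Sum>j\<le>n. arcsine_weight n j / (real i + 1/2 - real j))"
    unfolding sum_subtractf[symmetric] right_diff_distrib[symmetric] step by simp
  then show ?case using Suc sum_arcsine_weight_partial_fractions[of i n] by simp
qed

subsection \<open>The kernel as a digamma function\<close>

lemma has_integral_Ioi_iff_Ici:
  fixes f :: "real \<Rightarrow> 'a::banach"
  shows "(f has_integral I) {a<..} \<longleftrightarrow> (f has_integral I) {a..}"
  by (rule has_integral_spike_set_eq; rule negligible_subset[of "{a}"]) auto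

lemma has_integral_exp_Ioi:
  assumes "a > 0"
  shows "((\<lambda>t::real. exp (- a * t)) has_integral 1 / a) {0<..}"
  using has_integral_exp_minus_to_infinity[OF assms, of 0]
  unfolding has_integral_Ioi_iff_Ici by simp

text \<open>The integrand is the integral of \<open>exp (- u * t)\<close> over \<open>u\<close> in
  \<open>{a..b}\<close>. Everything is nonnegative, so Tonelli allows integrating over
  \<open>t\<close> first, which leaves the integral of \<open>1 / u\<close>.\<close>

lemma Frullani_exp:
  assumes "0 < a" "a \<le> b"
  shows "((\<lambda>t::real. (exp (- a * t) - exp (- b * t)) / t) has_integral ln (b / a)) {0<..}"
proof -
  define f :: "real \<Rightarrow> real" where
    "f = (\<lambda>t. if t > 0 then (exp (- a * t) - exp (- b * t)) / t else 0)"
  define g :: "real \<Rightarrow> real \<Rightarrow> ennreal" where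
    "g = (\<lambda>u t. ennreal (exp (- u * t)) * indicator {a..b} u * indicator {0<..} t)"
  have "(\<integral>\<^sup>+t. ennreal (f t) \<partial>lborel) = (\<integral>\<^sup>+t. (\<integral>\<^sup>+u. g u t \<partial>lborel) \<partial>lborel)"
  proof (rule nn_integral_cong)
    fix t :: real
    show "ennreal (f t) = (\<integral>\<^sup>+u. g u t \<partial>lborel)"
    proof (cases "t > 0")
      case True
      have "(\<integral>\<^sup>+u. ennreal (exp (- u * t)) * indicator {a..b} u \<partial>lborel)
          = ennreal (- exp (- b * t) / t - - exp (- a * t) / t)"
        using True assms
        by (intro nn_integral_FTC_Icc) (auto intro!: derivative_eq_intros)
      then show ?thesis using True by (simp add: g_def f_def diff_divide_distrib)
    qed (simp add: g_def f_def)
  qed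
  also have "\<dots> = (\<integral>\<^sup>+u. (\<integral>\<^sup>+t. g u t \<partial>lborel) \<partial>lborel)"
    unfolding g_def by (rule lborel_pair.Fubini') measurable
  also have "\<dots> = (\<integral>\<^sup>+u. ennreal (1 / u) * indicator {a..b} u \<partial>lborel)"
  proof (rule nn_integral_cong)
    fix u :: real
    show "(\<integral>\<^sup>+t. g u t \<partial>lborel) = ennreal (1 / u) * indicator {a..b} u"
    proof (cases "u \<in> {a..b}")
      case True
      then have "(\<integral>\<^sup>+t. ennreal (exp (- u * t)) * indicator {0<..} t \<partial>lborel) = ennreal (1 / u)"
        using assms by (intro nn_integral_has_integral_lebesgue' has_integral_exp_Ioi) auto
      then show ?thesis using True by (simp add: g_def)
    qed (simp add: g_def)
  qed
  also have "\<dots> = ennreal (ln b - ln a)"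
    using assms by (intro nn_integral_FTC_Icc) (auto intro!: derivative_eq_intros)
  also have "ln b - ln a = ln (b / a)" using assms by (simp add: ln_div)
  finally have "(f has_integral ln (b / a)) UNIV"
    using assms by (intro nn_integral_has_integral) (auto simp: f_def)
  then show ?thesis
    unfolding f_def greaterThan_iff[symmetric] has_integral_restrict_UNIV .
qed

text \<open>A finite geometric sum combined with Frullani's integral gives integrands
  \<open>f N\<close> with integral \<open>harm N - ln (N + 1)\<close>. They converge to the desired
  integrand and are dominated by \<open>exp (- t)\<close>.\<close>

lemma has_integral_euler_mascheroni:
  "((\<lambda>t::real. exp (- t) / (1 - exp (- t)) - exp (- t) / t) has_integral euler_mascheroni) {0<..}"
proof -
  define g :: "real \<Rightarrow> real" where "g = (\<lambda>t. 1 / (1 - exp (- t)) - 1 / t)"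
  define f :: "nat \<Rightarrow> real \<Rightarrow> real" where
    "f = (\<lambda>N t. (exp (- t) - exp (- real (Suc N) * t)) * g t)"
  \<comment> \<open>Both bounds come from \<open>1 + x \<le> exp x\<close>, at
    \<open>x = - t\<close> and at \<open>x = t\<close>.\<close>
  have g: "0 \<le> g t" "g t \<le> 1" if "t > 0" for t
  proof -
    have pos: "1 - exp (- t) > 0" using that by simp
    have "1 - exp (- t) \<le> t" using exp_ge_add_one_self[of "- t"] by linarith
    then show "0 \<le> g t" using pos that by (simp add: g_def field_simps)
    have "(1 + t) * exp (- t) \<le> exp t * exp (- t)"
      using exp_ge_add_one_self[of t] by (intro mult_right_mono) auto
    then have "(1 + t) * exp (- t) \<le> 1" by (simp flip: exp_add)
    then have "t \<le> (1 + t) * (1 - exp (- t))" by (simp add: algebra_simps)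
    then show "g t \<le> 1" using pos that by (simp add: g_def field_simps)
  qed
  have f: "(f N has_integral (harm N - ln (real (Suc N)))) {0<..}" for N
  proof -
    have "((\<lambda>t. (\<Sum>k<N. exp (- real (Suc k) * t))) has_integral (\<Sum>k<N. 1 / real (Suc k))) {0<..}"
      by (intro has_integral_sum has_integral_exp_Ioi) auto
    from has_integral_diff[OF this Frullani_exp[of 1 "real (Suc N)"]]
    have "((\<lambda>t. (\<Sum>k<N. exp (- real (Suc k) * t)) - (exp (- 1 * t) - exp (- real (Suc N) * t)) / t)
        has_integral (harm N - ln (real (Suc N)))) {0<..}"
      by (simp add: harm_altdef inverse_eq_divide)
    moreover have "(\<Sum>k<N. exp (- real (Suc k) * t)) - (exp (- 1 * t) - exp (- real (Suc N) * t)) / t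
        = f N t" if "t \<in> {0<..}" for t
    proof -
      have "exp (- real (Suc k) * t) = exp (- t) * exp (- t) ^ k" for k
        by (simp flip: exp_of_nat_mult exp_add add: algebra_simps)
      then have "(\<Sum>k<N. exp (- real (Suc k) * t)) = exp (- t) * (\<Sum>k<N. exp (- t) ^ k)"
        by (simp add: sum_distrib_left)
      also have "\<dots> = exp (- t) * ((1 - exp (- t) ^ N) / (1 - exp (- t)))"
        using that by (subst sum_gp_strict) auto
      also have "\<dots> = (exp (- t) - exp (- real (Suc N) * t)) / (1 - exp (- t))"
        by (simp flip: exp_of_nat_mult exp_add add: algebra_simps)
      finally show ?thesis by (simp add: f_def g_def right_diff_distrib)
    qed
    ultimately show ?thesis by (rule has_integral_eq[rotated])
  qed
  have f_le: "norm (f N t) \<le> exp (- t)" if "t \<in> {0<..}" for N t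
  proof -
    have *: "0 \<le> exp (- t) - exp (- real (Suc N) * t)" using that by (simp add: algebra_simps)
    then have "norm (f N t) = (exp (- t) - exp (- real (Suc N) * t)) * g t"
      using g[of t] that by (simp add: f_def abs_mult)
    also have "\<dots> \<le> (exp (- t) - exp (- real (Suc N) * t)) * 1"
      using g[of t] that * by (intro mult_left_mono) auto
    also have "\<dots> \<le> exp (- t)" by simp
    finally show ?thesis .
  qed
  have f_lim: "(\<lambda>N. f N t) \<longlonglongrightarrow> exp (- t) * g t" if "t \<in> {0<..}" for t
  proof -
    have "(\<lambda>N. exp (- t) ^ Suc N) \<longlonglongrightarrow> 0"
      using that by (intro LIMSEQ_Suc LIMSEQ_power_zero) auto
    moreover have "exp (- t) ^ Suc N = exp (- real (Suc N) * t)" for N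
      by (simp only: exp_of_nat_mult[symmetric] mult_minus_left mult_minus_right)
    ultimately have "(\<lambda>N. exp (- real (Suc N) * t)) \<longlonglongrightarrow> 0" by (simp only:)
    then have "(\<lambda>N. (exp (- t) - exp (- real (Suc N) * t)) * g t) \<longlonglongrightarrow> (exp (- t) - 0) * g t"
      by (intro tendsto_intros)
    then show ?thesis by (simp add: f_def)
  qed
  have dom: "(\<lambda>t::real. exp (- t)) integrable_on {0<..}"
    using has_integral_exp_Ioi[of 1] by (auto simp: integrable_on_def)
  note DC = dominated_convergence[OF has_integral_integrable[OF f] dom f_le f_lim]
  have "(\<lambda>N. harm N - ln (real (Suc N))) \<longlonglongrightarrow> (euler_mascheroni :: real)"
  proof -
    have "(\<lambda>N. (harm (Suc N) - ln (of_nat (Suc N))) - inverse (real (Suc N))) \<longlonglongrightarrow> euler_mascheroni - 0"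
      by (intro tendsto_diff LIMSEQ_Suc[OF euler_mascheroni_LIMSEQ] LIMSEQ_inverse_real_of_nat)
    then show ?thesis by (simp add: harm_Suc algebra_simps)
  qed
  then have "integral {0<..} (\<lambda>t. exp (- t) * g t) = euler_mascheroni"
    using DC(2) unfolding integral_unique[OF f] by (blast intro: LIMSEQ_unique)
  then have "((\<lambda>t. exp (- t) * g t) has_integral euler_mascheroni) {0<..}"
    using DC(1) by (simp add: has_integral_integral)
  then show ?thesis by (simp add: g_def algebra_simps)
qed

text \<open>The antiderivative \<open>- 2 * ln (1 + exp (- t / 2))\<close> rises from
  \<open>- 2 * ln 2\<close> to \<open>0\<close>.\<close>

lemma has_integral_two_ln_two:
  "((\<lambda>t::real. exp (- t / 2) / (1 + exp (- t / 2))) has_integral 2 * ln 2) {0<..}"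
proof -
  have "((\<lambda>t::real. exp (- t / 2) / (1 + exp (- t / 2))) has_integral 2 * ln 2) {0..}"
  proof (rule has_integral_to_inf)
    let ?f = "\<lambda>t::real. exp (- t / 2) / (1 + exp (- t / 2))"
    have cancel_two: "c * 2 / (2 + c * 2) = c / (1 + c)" if "c > 0" for c :: real
      using that by (simp add: divide_simps)
    have "(?f has_integral (- 2 * ln (1 + exp (- y / 2)) - - 2 * ln (1 + exp (- 0 / 2)))) {0..y}"
      if "0 \<le> y" for y
      using that
      by (intro fundamental_theorem_of_calculus)
         (auto intro!: derivative_eq_intros add_pos_pos simp: cancel_two
               simp flip: has_real_derivative_iff_has_vector_derivative)
    then have "\<forall>\<^sub>F y in at_top. 2 * ln 2 - 2 * ln (1 + exp (- y / 2)) = integral {0..y} ?f"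
      by (intro eventually_at_top_linorderI[of 0] sym[OF integral_unique]) fastforce
    moreover have "((\<lambda>y::real. 2 * ln 2 - 2 * ln (1 + exp (- y / 2))) \<longlongrightarrow> 2 * ln 2) at_top"
      by real_asymp
    ultimately show "((\<lambda>y. integral {0..y} ?f) \<longlongrightarrow> 2 * ln 2) at_top"
      by (rule Lim_transform_eventually[rotated])
    have "1 + exp (- t / 2) \<noteq> 0" for t :: real
      using exp_gt_zero[of "- t / 2"] by linarith
    then show "?f integrable_on {0..y}" for y
      by (intro integrable_continuous_real continuous_intros) auto
  qed (simp add: add_nonneg_nonneg)
  then show ?thesis by (simp add: has_integral_Ioi_iff_Ici)
qed

definition digamma_half :: real where
  "digamma_half = - euler_mascheroni - 2 * ln 2"

text \<open>Induction along the digamma recurrence: raising \<open>m\<close> by one multiplies the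
  second term by \<open>exp (- t)\<close>, so the denominator \<open>1 - exp (- t)\<close> cancels
  in the difference and a pure exponential with integral \<open>1 / (m + 1/2)\<close>
  remains.\<close>

lemma has_integral_psi_H:
  "((\<lambda>t::real. exp (- t) / t - exp (- t / 2) * (exp (- real m * t) / (1 - exp (- t))))
     has_integral digamma_half + odd_harm m) {0<..}"
proof (induction m)
  case 0
  have "((\<lambda>t::real. - (exp (- t) / (1 - exp (- t)) - exp (- t) / t)
      - exp (- t / 2) / (1 + exp (- t / 2))) has_integral - euler_mascheroni - 2 * ln 2) {0<..}"
    by (intro has_integral_diff has_integral_neg has_integral_euler_mascheroni
        has_integral_two_ln_two)
  moreover have "- (exp (- t) / (1 - exp (- t)) - exp (- t) / t) - exp (- t / 2) / (1 + exp (- t / 2))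
      = exp (- t) / t - exp (- t / 2) * (exp (- real 0 * t) / (1 - exp (- t)))"
    if "t \<in> {0<..}" for t
  proof -
    \<comment> \<open>With this \<open>u\<close> the base case is the identity
      \<open>u^2 / (1 - u^2) + u / (1 + u) = u / (1 - u^2)\<close>.\<close>
    define u where "u = exp (- t / 2)"
    have u: "0 < u" "u < 1" using that by (simp_all add: u_def)
    have uu: "exp (- t) = u * u" by (simp add: u_def flip: exp_add)
    have "1 - u * u = (1 - u) * (1 + u)" by (simp add: algebra_simps)
    then have "u * u / (1 - u * u) + u / (1 + u) = u / (1 - u * u)"
      using u by (simp add: divide_simps) (simp add: algebra_simps)
    then show ?thesis unfolding uu u_def[symmetric] by simp
  qed
  ultimately show ?case
    unfolding digamma_half_def odd_harm_def by (subst has_integral_cong[symmetric]) simp_all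
next
  case (Suc m)
  have "((\<lambda>t::real. exp (- (real m + 1/2) * t)) has_integral 1 / (real m + 1/2)) {0<..}"
    by (rule has_integral_exp_Ioi) simp
  note has_integral_add[OF Suc this]
  moreover have "exp (- t) / t - exp (- t / 2) * (exp (- real m * t) / (1 - exp (- t)))
      + exp (- (real m + 1/2) * t)
      = exp (- t) / t - exp (- t / 2) * (exp (- real (Suc m) * t) / (1 - exp (- t)))"
    if "t \<in> {0<..}" for t
  proof -
    define u where "u = exp (- t / 2) * exp (- real m * t)"
    have "u = u * (1 - exp (- t)) / (1 - exp (- t))" using that by simp
    also have "\<dots> = u / (1 - exp (- t)) - u * exp (- t) / (1 - exp (- t))"
      by (simp add: right_diff_distrib diff_divide_distrib)
    finally have "u / (1 - exp (- t)) - u = u * exp (- t) / (1 - exp (- t))" by simp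
    moreover have "u * exp (- t) = exp (- t / 2) * exp (- real (Suc m) * t)"
      by (simp add: u_def algebra_simps flip: exp_add)
    moreover have "u = exp (- (real m + 1/2) * t)"
      by (simp add: u_def algebra_simps flip: exp_add)
    moreover have "exp (- t / 2) * (exp (- real m * t) / (1 - exp (- t))) = u / (1 - exp (- t))"
      by (simp add: u_def)
    ultimately show ?thesis by (simp only: times_divide_eq_right)
  qed
  ultimately show ?case
    unfolding odd_harm_def by (subst has_integral_cong[symmetric]) (simp_all add: add.assoc)
qed

lemma psi_H_eq:
  assumes H: "\<And>t. t \<ge> 0 \<Longrightarrow> H t = exp (- t / 2)"
  shows "psi_H H (real m) = digamma_half + odd_harm m"
  unfolding psi_H_def
  by (rule integral_unique, rule has_integral_eq[OF _ has_integral_psi_H]) (simp add: H)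

subsection \<open>Negativity of the form on the hyperplane\<close>

definition form :: "nat \<Rightarrow> (nat \<Rightarrow> nat \<Rightarrow> real) \<Rightarrow> (nat \<Rightarrow> real) \<Rightarrow> real" where
  "form n K x = (\<Sum>i\<le>n. \<Sum>j\<le>n. x i * x j * K i j)"

text \<open>
  The squared partial sums are those of the Cholesky decomposition of the
  autoregressive covariance \<open>r\<^bsup>|i - j|\<^esup>\<close>.
\<close>
lemma form_power_ndist:
  fixes r :: real
  defines "A \<equiv> \<lambda>n x. \<Sum>i\<le>n. x i * r ^ (n - i)"
  shows "form n (\<lambda>i j. r ^ ndist i j) x = (A n x)\<^sup>2 + (1 - r\<^sup>2) * (\<Sum>k<n. (A k x)\<^sup>2)"
proof (induction n)
  case 0
  then show ?case by (simp add: form_def A_def ndist_def power2_eq_square)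
next
  case (Suc n)
  have 1: "(\<Sum>i\<le>n. x i * r ^ (Suc n - i)) = r * A n x"
    unfolding A_def sum_distrib_left by (intro sum.cong) (auto simp: Suc_diff_le)
  then have A: "A (Suc n) x = r * A n x + x (Suc n)"
    by (simp add: A_def)
  have "form (Suc n) (\<lambda>i j. r ^ ndist i j) x = form n (\<lambda>i j. r ^ ndist i j) x
      + (\<Sum>i\<le>n. x i * x (Suc n) * r ^ ndist i (Suc n))
      + (\<Sum>j\<le>n. x (Suc n) * x j * r ^ ndist (Suc n) j) + x (Suc n) * x (Suc n)"
    by (simp add: form_def sum.distrib ndist_def)
  also have "(\<Sum>i\<le>n. x i * x (Suc n) * r ^ ndist i (Suc n)) = r * A n x * x (Suc n)"
    unfolding 1[symmetric] sum_distrib_right by (intro sum.cong) (auto simp: ndist_def)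
  also have "(\<Sum>j\<le>n. x (Suc n) * x j * r ^ ndist (Suc n) j) = r * A n x * x (Suc n)"
    unfolding 1[symmetric] sum_distrib_right by (intro sum.cong) (auto simp: ndist_def)
  \<comment> \<open>With \<open>a = A n x\<close> and \<open>b = x (Suc n)\<close>:
    \<open>a^2 + 2*r*a*b + b^2 = (r*a + b)^2 + (1 - r^2)*a^2\<close>.\<close>
  finally show ?case by (simp add: Suc A power2_eq_square algebra_simps)
qed

text \<open>The map from \<open>x\<close> to its partial sums \<open>A 0, ..., A n\<close> is
  unitriangular, so some \<open>A k\<close> is nonzero; each square has positive weight,
  \<open>1\<close> or \<open>1 - r\<^sup>2\<close>.\<close>

lemma form_power_ndist_pos:
  fixes r :: real
  assumes "0 < r" "r < 1" and x: "m \<le> n" "x m \<noteq> 0"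
  shows "form n (\<lambda>i j. r ^ ndist i j) x > 0"
proof -
  define A where "A n = (\<Sum>i\<le>n. x i * r ^ (n - i))" for n
  have r: "1 - r\<^sup>2 > 0" using assms by (simp add: power_less_one_iff abs_square_less_1)
  have ex: "\<exists>k\<le>n. A k \<noteq> 0"
  proof (rule ccontr)
    assume *: "\<not> ?thesis"
    have "x k = 0" if "k \<le> n" for k
      using that
    proof (induction k rule: less_induct)
      case (less k)
      have "A k = x k + (\<Sum>i<k. x i * r ^ (k - i))"
        by (simp add: A_def lessThan_Suc_atMost[symmetric])
      also have "(\<Sum>i<k. x i * r ^ (k - i)) = 0"
        using less by (intro sum.neutral) auto
      finally show ?case using * less.prems by simp
    qed
    then show False using x by blast
  qed
  have sum: "0 \<le> (\<Sum>k<n. (A k)\<^sup>2)" by (intro sum_nonneg) auto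
  have "form n (\<lambda>i j. r ^ ndist i j) x = (A n)\<^sup>2 + (1 - r\<^sup>2) * (\<Sum>k<n. (A k)\<^sup>2)"
    unfolding form_power_ndist A_def ..
  also have "\<dots> > 0"
  proof (cases "A n = 0")
    case True
    then obtain k where "k < n" "A k \<noteq> 0" using ex by (metis le_neq_implies_less)
    then have "0 < (\<Sum>k<n. (A k)\<^sup>2)" by (intro sum_pos2[of _ k]) auto
    then show ?thesis using r True by simp
  next
    case False
    then show ?thesis using r sum by (intro add_pos_nonneg mult_nonneg_nonneg) auto
  qed
  finally show ?thesis .
qed

text \<open>
  On the hyperplane the singular term of the integrand cancels, so that minus the form is an
  integral of autoregressive forms.
\<close>
lemma form_odd_harm_neg:
  assumes sum0: "(\<Sum>i\<le>n. x i) = 0" and x: "m \<le> n" "x m \<noteq> 0"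
  shows "form n (\<lambda>i j. digamma_half + odd_harm (ndist i j)) x < 0"
proof -
  let ?I = "form n (\<lambda>i j. digamma_half + odd_harm (ndist i j)) x"
  define g where "g t = exp (- t / 2) / (1 - exp (- t)) * form n (\<lambda>i j. exp (- t) ^ ndist i j) x"
    for t :: real
  have "((\<lambda>t. form n (\<lambda>i j. exp (- t) / t
      - exp (- t / 2) * (exp (- real (ndist i j) * t) / (1 - exp (- t)))) x) has_integral ?I) {0<..}"
    unfolding form_def
    by (intro has_integral_sum has_integral_mult_right has_integral_psi_H) auto
  moreover have "form n (\<lambda>i j. exp (- t) / t
      - exp (- t / 2) * (exp (- real (ndist i j) * t) / (1 - exp (- t)))) x = - g t" for t
  proof -
    have "form n (\<lambda>i j. exp (- t) / t
        - exp (- t / 2) * (exp (- real (ndist i j) * t) / (1 - exp (- t)))) x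
        = (\<Sum>i\<le>n. \<Sum>j\<le>n. x i * x j * (exp (- t) / t)) - g t"
      unfolding form_def g_def sum_distrib_left sum_subtractf[symmetric]
      by (intro sum.cong) (auto simp: algebra_simps simp flip: exp_of_nat_mult)
    also have "(\<Sum>i\<le>n. \<Sum>j\<le>n. x i * x j * (exp (- t) / t))
        = (\<Sum>i\<le>n. x i) * (\<Sum>j\<le>n. x j) * (exp (- t) / t)"
      by (subst sum_product) (simp only: sum_distrib_right)
    finally show ?thesis by (simp add: sum0)
  qed
  ultimately have "((\<lambda>t. - g t) has_integral ?I) {0<..}" by simp
  from has_integral_neg[OF this] have I: "(g has_integral - ?I) {0<..}" by simp
  have g_pos: "g t > 0" if "t > 0" for t
    using that x unfolding g_def
    by (intro mult_pos_pos divide_pos_pos form_power_ndist_pos) auto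
  \<comment> \<open>Strictness is obtained on a compact interval away from \<open>0\<close>: there
    \<open>g\<close> is continuous, and a vanishing integral would force
    \<open>g 1 = 0\<close>.\<close>
  have cont: "continuous_on {1..2} g"
    unfolding g_def form_def by (intro continuous_intros) auto
  have g12: "g integrable_on {1..2}" using cont by (rule integrable_continuous_real)
  have "integral {1..2} g \<le> - ?I"
    using I g_pos by (intro has_integral_subset_le[OF _ integrable_integral[OF g12] I]) (auto intro: less_imp_le)
  moreover have "integral {1..2} g \<ge> 0"
    using g_pos by (intro integral_nonneg g12) (auto intro: less_imp_le)
  moreover have "integral {1..2} g \<noteq> 0"
  proof
    assume "integral {1..2} g = 0"
    then have "(g has_integral 0) (cbox 1 2)" using g12 by (metis cbox_interval integrable_integral)
    then have "g 1 = 0"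
      using cont g_pos by (intro has_integral_0_cbox_imp_0[of 1 2 g]) (auto intro: less_imp_le)
    then show False using g_pos[of 1] by simp
  qed
  ultimately show ?thesis by linarith
qed

subsection \<open>Reduction to a harmonic number\<close>

text \<open>Applying \<open>K\<close> to the weights gives a constant vector, so the cross terms are
  multiples of the coordinate sum of \<open>y\<close>, which is zero.\<close>

lemma form_arcsine_decomposition:
  fixes y :: "nat \<Rightarrow> real" and n :: nat
  defines "K \<equiv> \<lambda>i j. digamma_half + odd_harm (ndist i j)"
  assumes "(\<Sum>i\<le>n. y i) = 0"
  shows "form n K (\<lambda>k. s * arcsine_weight n k + y k)
    = s\<^sup>2 * (digamma_half + harm n) + form n K y"
proof -
  let ?w = "arcsine_weight n" and ?l = "digamma_half + harm n"
  have row: "(\<Sum>j\<le>n. ?w j * K i j) = ?l" if "i \<le> n" for i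
    using that sum_arcsine_weight_ndist[of i n] sum_arcsine_weight[of n]
    by (simp add: K_def distrib_left sum.distrib flip: sum_distrib_right)
  have row': "(\<Sum>i\<le>n. ?w i * K i j) = ?l" if "j \<le> n" for j
    using row[OF that] by (simp add: K_def ndist_commute)
  have ww: "(\<Sum>i\<le>n. \<Sum>j\<le>n. ?w i * ?w j * K i j) = ?l"
    using row sum_arcsine_weight[of n]
    by (simp add: mult.assoc flip: sum_distrib_left sum_distrib_right)
  have yw: "(\<Sum>i\<le>n. \<Sum>j\<le>n. y i * ?w j * K i j) = 0"
    using row assms by (simp add: mult.assoc flip: sum_distrib_left sum_distrib_right)
  have "(\<Sum>i\<le>n. \<Sum>j\<le>n. ?w i * y j * K i j) = (\<Sum>j\<le>n. \<Sum>i\<le>n. y j * (?w i * K i j))"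
    by (subst sum.swap) (simp add: mult_ac)
  also have "\<dots> = 0"
    using row' assms by (simp flip: sum_distrib_left sum_distrib_right)
  finally have wy: "(\<Sum>i\<le>n. \<Sum>j\<le>n. ?w i * y j * K i j) = 0" .
  have "form n K (\<lambda>k. s * ?w k + y k) =
      s\<^sup>2 * (\<Sum>i\<le>n. \<Sum>j\<le>n. ?w i * ?w j * K i j) + s * (\<Sum>i\<le>n. \<Sum>j\<le>n. ?w i * y j * K i j)
      + s * (\<Sum>i\<le>n. \<Sum>j\<le>n. y i * ?w j * K i j) + form n K y"
    unfolding form_def sum_distrib_left sum.distrib[symmetric]
    by (intro sum.cong) (auto simp: algebra_simps power2_eq_square)
  then show ?thesis by (simp add: ww wy yw)
qed

text \<open>Since \<open>25 < 8 * pi < 26\<close>, the standard bounds for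
  \<open>harm n - ln (n + 1)\<close> against the Euler constant decide \<open>n = 24\<close> and
  \<open>n = 25\<close>; monotonicity of \<open>harm\<close> does the rest.\<close>

lemma
  shows ln_two_pi_gt: "n \<le> 24 \<Longrightarrow> digamma_half + harm n < ln (2 * pi)"
    and ln_two_pi_less: "n \<ge> 25 \<Longrightarrow> ln (2 * pi) < digamma_half + harm n"
proof -
  have *: "ln (2 * pi) - digamma_half = ln (8 * pi) + euler_mascheroni"
  proof -
    have "ln (8 * pi) = ln (2 * pi) + ln (2 ^ 2)"
      using ln_mult[of "2 * pi" "2 ^ 2"] by simp
    then show ?thesis using ln_realpow[of 2 2] by (simp add: digamma_half_def)
  qed
  have "harm 24 \<le> ln (25 :: real) + euler_mascheroni"
    using euler_mascheroni_lower[of 23] by simp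
  also have "ln 25 < ln (8 * pi)" using pi_approx by simp
  finally have 24: "harm 24 < ln (8 * pi) + euler_mascheroni" by simp
  \<comment> \<open>The error term \<open>1 / (2 * 25)\<close> of the upper bound used for
    \<open>harm 25\<close>; it fits because \<open>8 * pi * exp (1 / 50)\<close> is still below
    \<open>26\<close>.\<close>
  have "exp (1 / 50) \<le> 1 + 1 / 50 + (1 / 50 :: real)\<^sup>2" by (rule exp_bound) auto
  then have "8 * pi * exp (1 / 50) \<le> 8 * pi * (1 + 1 / 50 + (1 / 50)\<^sup>2)" by simp
  also have "\<dots> < 26" using pi_approx by (simp add: power2_eq_square)
  finally have "ln (8 * pi * exp (1 / 50)) < ln 26" by (subst ln_less_cancel_iff) auto
  then have "ln (8 * pi) + 1 / 50 < ln 26" by (simp add: ln_mult)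
  then have 25: "harm 25 > ln (8 * pi) + euler_mascheroni"
    using euler_mascheroni_upper[of 24] by simp
  show "digamma_half + harm n < ln (2 * pi)" if "n \<le> 24"
    using harm_mono[OF that, where ?'a = real] 24 * by linarith
  show "ln (2 * pi) < digamma_half + harm n" if "n \<ge> 25"
    using harm_mono[OF that, where ?'a = real] 25 * by linarith
qed

text \<open>Keeping \<open>s\<close> and \<open>y\<close> free lets one identity serve both the
  binomial vector (\<open>y = 0\<close>) and an arbitrary vector.\<close>

lemma discriminant_form_eq:
  assumes H: "\<And>t. t \<ge> 0 \<Longrightarrow> H t = exp (- t / 2)"
    and x: "\<And>k. k \<le> n \<Longrightarrow> vec_index x k = s * arcsine_weight n k + y k"
    and y: "(\<Sum>k\<le>n. y k) = 0"
  shows "ln (2 * pi) * (phi_form n x)\<^sup>2 - q_form H n x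
    = s\<^sup>2 * (ln (2 * pi) - (digamma_half + harm n))
      - form n (\<lambda>i j. digamma_half + odd_harm (ndist i j)) y"
proof -
  have "phi_form n x = s"
    using x y sum_arcsine_weight[of n]
    by (simp add: phi_form_def sum.distrib flip: sum_distrib_left)
  moreover have "q_form H n x =
      form n (\<lambda>i j. digamma_half + odd_harm (ndist i j)) (\<lambda>k. s * arcsine_weight n k + y k)"
    unfolding q_form_def form_def
    by (intro sum.cong) (simp_all add: x psi_H_eq[OF H] flip: real_ndist)
  ultimately show ?thesis
    unfolding form_arcsine_decomposition[OF y] by (simp add: algebra_simps)
qed

theorem corollary2p13:
  fixes H :: "real \<Rightarrow> real" and n :: nat
  assumes H: "\<And>t. t \<ge> 0 \<Longrightarrow> H t = exp (- t / 2)"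
  shows "(positive_definite_on (n + 1) (\<lambda>x. ln (2 * pi) * (phi_form n x)\<^sup>2 - q_form H n x)
            \<longleftrightarrow> n \<le> 24) \<and>
         (n \<ge> 25 \<longrightarrow>
            (let v = vec (n + 1) (\<lambda>k. real ((2 * k) choose k) * real ((2 * (n - k)) choose (n - k)))
             in ln (2 * pi) * (phi_form n v)\<^sup>2 - q_form H n v < 0))"
proof -
  define v where
    "v = vec (n + 1) (\<lambda>k. real ((2 * k) choose k) * real ((2 * (n - k)) choose (n - k)))"
  let ?Q = "\<lambda>x. ln (2 * pi) * (phi_form n x)\<^sup>2 - q_form H n x"
  \<comment> \<open>The \<open>+ 0\<close> matches the shape
    \<open>s * arcsine_weight n k + y k\<close>, with \<open>s = 4 ^ n\<close> and
    \<open>y = 0\<close>.\<close>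
  have v: "vec_index v k = 4 ^ n * arcsine_weight n k + 0" if "k \<le> n" for k
    using that
    by (simp add: v_def central_binomial_eq arcsine_weight_def flip: power_add)
  have Q_v: "?Q v = (4 ^ n)\<^sup>2 * (ln (2 * pi) - (digamma_half + harm n))"
    by (subst discriminant_form_eq[OF H v]) (simp_all add: form_def)
  have v_dim: "v \<in> carrier_vec (n + 1)" by (simp add: v_def)
  have "vec_index v 0 \<noteq> 0" by (simp add: v_def)
  then have v_nonzero: "v \<noteq> 0\<^sub>v (n + 1)" by auto
  have "?Q x > 0" if "n \<le> 24" and x: "x \<in> carrier_vec (n + 1)" "x \<noteq> 0\<^sub>v (n + 1)" for x
  proof -
    define s where "s = phi_form n x"
    define y where "y k = vec_index x k - s * arcsine_weight n k" for k
    have y: "(\<Sum>k\<le>n. y k) = 0"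
      using sum_arcsine_weight[of n]
      by (simp add: y_def s_def phi_form_def sum_subtractf flip: sum_distrib_left)
    have Q: "?Q x = s\<^sup>2 * (ln (2 * pi) - (digamma_half + harm n))
        - form n (\<lambda>i j. digamma_half + odd_harm (ndist i j)) y"
      by (rule discriminant_form_eq[OF H _ y]) (simp_all add: y_def)
    have gap: "ln (2 * pi) - (digamma_half + harm n) > 0"
      using ln_two_pi_gt[OF \<open>n \<le> 24\<close>] by simp
    show ?thesis
    \<comment> \<open>If \<open>y\<close> is nonzero, the hyperplane part is strictly positive;
      otherwise \<open>x\<close> is \<open>s\<close> times the weights with \<open>s\<close>
      nonzero, and the gap decides.\<close>
    proof (cases "\<exists>m\<le>n. y m \<noteq> 0")
      case True
      then have "form n (\<lambda>i j. digamma_half + odd_harm (ndist i j)) y < 0"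
        using form_odd_harm_neg[OF y] by blast
      then show ?thesis unfolding Q using gap
        by (smt (verit) mult_nonneg_nonneg zero_le_power2)
    next
      case False
      then have "form n (\<lambda>i j. digamma_half + odd_harm (ndist i j)) y = 0"
        by (simp add: form_def)
      moreover have "s \<noteq> 0"
      proof
        assume "s = 0"
        then have "x = 0\<^sub>v (n + 1)"
          using False x(1) by (intro eq_vecI) (auto simp: y_def)
        then show False using x(2) by simp
      qed
      ultimately show ?thesis unfolding Q using gap by simp
    qed
  qed
  then have pos: "n \<le> 24 \<Longrightarrow> positive_definite_on (n + 1) ?Q"
    by (simp add: positive_definite_on_def)
  have neg: "?Q v < 0" if "n \<ge> 25"
    using ln_two_pi_less[OF that] unfolding Q_v by (simp add: mult_less_0_iff)
  have "positive_definite_on (n + 1) ?Q \<longleftrightarrow> n \<le> 24"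
  proof
    assume "positive_definite_on (n + 1) ?Q"
    then have "?Q v > 0" using v_dim v_nonzero by (simp add: positive_definite_on_def)
    then show "n \<le> 24" using neg by (cases "n \<ge> 25") auto
  qed (rule pos)
  then show ?thesis using neg unfolding v_def Let_def by blast
qed

end
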